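(* There exists an absolute constant $C>0$ such that the following holds. Let $n\geq 2$, $\theta\in(0,1)$, and let $\mathcal{A},\mathcal{B}\subseteq 2^{[n]}$ satisfy $d(\mathcal{A},\mathcal{B})\geq 2^{-\theta n}$. Then $$|\mathcal{A}||\mathcal{B}|\leq \exp\!\Big(C\max\{\theta n,\sqrt{\theta n\log_2 n}\}\Big)\,2^{n(1+\theta\log_2(1/\theta))}.$$
   Context: For families $\mathcal{A},\mathcal{B}\subseteq 2^{[n]}$, $d(\mathcal{A},\mathcal{B})$ is the number of pairs $(A,B)\in\mathcal{A}\times\mathcal{B}$ with $A\cap B=\varnothing$ divided by $|\mathcal{A}||\mathcal{B}|$. *)

theory Defs
  imports Complex_Main
begin

text \<open>
  The density of disjoint pairs. If one of the families is empty, the value is 0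
  (division by zero), so no positive lower bound on the density holds in that case.
\<close>

definition disjoint_density :: "'a set set \<Rightarrow> 'a set set \<Rightarrow> real" where
  "disjoint_density \<A> \<B> =
     real (card {(A, B) \<in> \<A> \<times> \<B>. A \<inter> B = {}}) / (real (card \<A>) * real (card \<B>))"

end

theory Submission
  imports Defs "HOL-Real_Asymp.Real_Asymp"
begin

text \<open>
  Tensorisation of a two-point inequality. With m = Suc k, write N for the number of disjoint pairs;
  splitting both families along one element of the ground set shows by induction that
  N^m is at most \<Lambda>^n times the k-th power of the product of the cardinalities, provided
  the case n = 1 holds in weighted form. Maximising over one of its two weights (Hoelder) reduces
  this case to
  (1 + t^k)^m + 1 \<le> \<Lambda> (1 + t^m)^k for all t \<ge> 0, and for large m the value \<Lambda> = 2 + 3/2^m suffices,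
  the critical point being t = 1/2. For density 2^(-\<theta>n) one takes m to be log_2(1/\<theta>) rounded up,
  so that 2^(-m) \<le> \<theta>. If \<theta> is bounded below, the trivial bound 4^n is good enough.
\<close>

section \<open>Hoelder's inequality for two terms\<close>

text \<open>Each term \<open>a * b ^ k\<close> lies below a tangent bound, linear in
  \<open>a ^ Suc k\<close> and \<open>b ^ Suc k\<close>, with a free parameter \<open>\<mu>\<close>.
  The two bounds are added and the best \<open>\<mu>\<close> is inserted.\<close>

lemma Hoelder_two_point:
  fixes a0 a1 b0 b1 :: real
  assumes "a0 \<ge> 0" "a1 \<ge> 0" "b0 \<ge> 0" "b1 \<ge> 0"
  shows "(a0 * b0 ^ k + a1 * b1 ^ k) ^ Suc k
    \<le> (a0 ^ Suc k + a1 ^ Suc k) * (b0 ^ Suc k + b1 ^ Suc k) ^ k"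
proof -
  define S where "S = b0 ^ Suc k + b1 ^ Suc k"
  define T where "T = a0 * b0 ^ k + a1 * b1 ^ k"
  \<comment> \<open>Weighted AM-GM for \<open>a\<close> and \<open>\<mu> * b\<close>, obtained from
    Bernoulli's inequality for the ratio \<open>a / c\<close> with
    \<open>c = \<mu> * b\<close>.\<close>
  have tangent: "real (Suc k) * \<mu> ^ k * a * b ^ k \<le> a ^ Suc k + real k * \<mu> ^ Suc k * b ^ Suc k"
    if "a \<ge> 0" "b \<ge> 0" "\<mu> \<ge> 0" for a b \<mu> :: real
  proof (cases "\<mu> * b = 0")
    case True
    then show ?thesis using that by (cases k) (auto simp: power_mult_distrib)
  next
    case False
    then have pos: "\<mu> * b > 0" using that by (simp add: less_le)
    define c where "c = \<mu> * b"
    have c: "c > 0" using pos by (simp add: c_def)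
    then have ca: "c * (a / c) = a" by simp
    have "(1 + (a / c - 1)) ^ Suc k \<ge> 1 + real (Suc k) * (a / c - 1)"
      using that c by (intro Bernoulli_inequality) simp
    then have "c ^ Suc k * (1 + real (Suc k) * (a / c - 1)) \<le> c ^ Suc k * (a / c) ^ Suc k"
      using c by (intro mult_left_mono) auto
    also have "\<dots> = a ^ Suc k"
      unfolding power_mult_distrib[symmetric] ca ..
    also have "c ^ Suc k * (1 + real (Suc k) * (a / c - 1))
       = c ^ k * (real (Suc k) * (c * (a / c)) - real k * c)"
      by (simp add: algebra_simps)
    also have "\<dots> = real (Suc k) * \<mu> ^ k * a * b ^ k - real k * \<mu> ^ Suc k * b ^ Suc k"
      unfolding ca unfolding c_def by (simp add: algebra_simps power_mult_distrib)
    finally show ?thesis by simp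
  qed
  show ?thesis
  proof (cases "S = 0")
    case True
    then have "b0 ^ Suc k = 0 \<and> b1 ^ Suc k = 0"
      using assms unfolding S_def by (subst (asm) add_nonneg_eq_0_iff) auto
    then have "b0 = 0" "b1 = 0"
      by (simp_all only: power_eq_0_iff)
    then show ?thesis by (cases k) (use assms in auto)
  next
    case False
    then have S: "S > 0" using assms unfolding S_def by (simp add: less_le)
    have T: "T \<ge> 0" using assms by (simp add: T_def)
    \<comment> \<open>This value maximises
      \<open>(k + 1) * \<mu> ^ k * T - k * \<mu> ^ Suc k * S\<close>, the lower bound for
      \<open>a0 ^ Suc k + a1 ^ Suc k\<close> that the added tangent bounds give.\<close>
    define \<mu> where "\<mu> = T / S"
    have mu: "\<mu> \<ge> 0" using S T by (simp add: \<mu>_def)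
    have TS: "T = \<mu> * S" using S by (simp add: \<mu>_def)
    have "real (Suc k) * \<mu> ^ k * T \<le> a0 ^ Suc k + a1 ^ Suc k + real k * \<mu> ^ Suc k * S"
      using tangent[of a0 b0 \<mu>] tangent[of a1 b1 \<mu>] assms mu
      unfolding T_def S_def by (simp add: algebra_simps)
    then have "\<mu> ^ Suc k * S \<le> a0 ^ Suc k + a1 ^ Suc k"
      unfolding TS by (simp add: algebra_simps)
    then have "\<mu> ^ Suc k * S * S ^ k \<le> (a0 ^ Suc k + a1 ^ Suc k) * S ^ k"
      using S by (intro mult_right_mono) auto
    moreover have "\<mu> ^ Suc k * S * S ^ k = T ^ Suc k"
      unfolding TS by (simp add: power_mult_distrib)
    ultimately show ?thesis unfolding T_def S_def by simp
  qed
qed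

section \<open>The one-variable kernel inequality for large \<open>k\<close>\<close>

text \<open>With \<open>w = t ^ k\<close> and \<open>m = k + 1\<close>, low-order estimates of both
  powers reduce the claim to \<open>m * w + (m * w)^2 <= 2 * k * t * w + 3 / 2 ^ m\<close>. For
  larger \<open>t\<close> the linear term on the right dominates; for smaller \<open>t\<close> two
  thirds of the correction pay for the linear excess and one third for the square.\<close>

lemma kernel_bound_small_weight:
  fixes t :: real
  assumes t: "t \<ge> 0" and k: "k \<ge> 20" and weight: "real (Suc k) * t ^ k \<le> 1/10"
    and decay: "real (Suc k) ^ 2 * (18/25) ^ k \<le> 1/2"
  shows "(1 + t ^ k) ^ Suc k + 1 \<le> (2 + 3 / 2 ^ Suc k) * (1 + t ^ Suc k) ^ k"
proof -
  define w where "w = t ^ k"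
  define m where "m = real (Suc k)"
  have w: "w \<ge> 0" and tw: "t ^ Suc k = t * w" using t by (simp_all add: w_def)
  have m: "m \<ge> 21" "real k = m - 1" using k by (simp_all add: m_def)
  define Q where "Q = (1 + t * w) ^ k"
  have twn: "t * w \<ge> 0" using t w by simp
  have Q: "Q \<ge> 1 + real k * (t * w)"
    unfolding Q_def using twn by (intro Bernoulli_inequality) simp
  then have Q1: "Q \<ge> 1" using twn by (smt (verit) mult_nonneg_nonneg of_nat_0_le_iff)
  have small: "m * w \<le> 1/10" using weight by (simp only: m_def w_def)
  have "(1 + w) ^ Suc k + 1 \<le> (2 + 3 / 2 ^ Suc k) * Q"
  proof -
    have "(1 + w) ^ Suc k \<le> exp w ^ Suc k"
      using w by (intro power_mono) auto
    also have "\<dots> = exp (m * w)" by (simp only: m_def exp_of_nat_mult)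
    also have "\<dots> \<le> 1 + m * w + (m * w)\<^sup>2"
      using small w m by (intro exp_bound) auto
    finally have up: "(1 + w) ^ Suc k \<le> 1 + m * w + (m * w)\<^sup>2" .
    have low: "(2 + 3 / 2 ^ Suc k) * Q \<ge> 2 * Q + 3 / 2 ^ Suc k"
      using mult_left_mono[OF Q1, of "3 / 2 ^ Suc k"] by (simp add: algebra_simps)
    show ?thesis
    \<comment> \<open>The split point is far enough above 1/2 for \<open>2 * k * t\<close> to beat
      \<open>m * (1 + m * w)\<close> beyond it, while \<open>2 * (3/5)^2 = 18/25 < 1\<close> makes
      \<open>(m * w)^2\<close> negligible against \<open>1 / 2 ^ m\<close> below it.\<close>
    proof (cases "t \<le> 3/5")
      case True
      have "m * w - 2 * real k * t * w \<le> 2 / 2 ^ Suc k"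
      proof (cases "t = 0")
        case True
        then show ?thesis using k by (simp add: w_def zero_power)
      next
        case False
        then have tp: "2 * t > 0" using t by simp
        \<comment> \<open>the left side is maximal at t = 1/2; Bernoulli for 1/(2t) avoids differentiating\<close>
        have "1 + real (Suc k) * (1/(2*t) - 1) \<le> (1 + (1/(2*t) - 1)) ^ Suc k"
          using tp by (intro Bernoulli_inequality) simp
        then have "(1 + m * (1/(2*t) - 1)) * (2*t) ^ Suc k \<le> (1/(2*t)) ^ Suc k * (2*t) ^ Suc k"
          using tp by (intro mult_right_mono) (auto simp: m_def)
        also have "\<dots> = 1" using tp by (simp only: power_mult_distrib[symmetric]) simp
        also have "(1 + m * (1/(2*t) - 1)) * (2*t) ^ Suc k = 2 ^ k * (m * w - 2 * real k * t * w)"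
        proof -
          have "(1 + m * (1/(2*t) - 1)) * (2*t) = m - 2 * real k * t"
            unfolding m(2) using tp by (simp add: field_simps)
          then have "(1 + m * (1/(2*t) - 1)) * (2*t) ^ Suc k = (m - 2 * real k * t) * (2*t) ^ k"
            by (simp only: power_Suc mult.assoc[symmetric])
          then show ?thesis by (simp add: w_def power_mult_distrib algebra_simps)
        qed
        finally show ?thesis by (simp add: field_simps)
      qed
      moreover have "(m * w)\<^sup>2 \<le> 1 / 2 ^ Suc k"
      proof -
        have "w \<le> (3/5) ^ k" unfolding w_def using t True by (intro power_mono) auto
        then have "m * w \<le> m * (3/5) ^ k" using m by (intro mult_left_mono) auto
        then have "(m * w)\<^sup>2 \<le> (m * (3/5) ^ k)\<^sup>2" using m w by (intro power_mono) auto
        also have "2 ^ k * ((3/5) ^ k)\<^sup>2 = (18/25 :: real) ^ k"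
          by (simp only: power2_eq_square power_mult_distrib[symmetric]) simp
        then have "2 ^ Suc k * (m * (3/5) ^ k)\<^sup>2 = 2 * (m\<^sup>2 * (18/25) ^ k)"
          by (simp add: power_mult_distrib)
        then have "2 ^ Suc k * (m * (3/5) ^ k)\<^sup>2 \<le> 1"
          using decay by (simp add: m_def)
        then have "(m * (3/5) ^ k)\<^sup>2 \<le> 1 / 2 ^ Suc k"
          by (simp add: pos_le_divide_eq mult.commute)
        finally show ?thesis .
      qed
      ultimately have "m * w + (m * w)\<^sup>2 \<le> 2 * real k * t * w + 3 / 2 ^ Suc k"
        by (simp add: add_divide_distrib)
      then show ?thesis using up low Q by simp
    next
      case False
      have "m + m * (m * w) \<le> m + m * (1/10)" using small m by (intro add_left_mono mult_left_mono) auto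
      also have "\<dots> \<le> 2 * real k * (3/5)" using m by simp
      also have "\<dots> \<le> 2 * real k * t" using False by (intro mult_left_mono) auto
      finally have "(m + m * (m * w)) * w \<le> 2 * real k * t * w"
        using w by (intro mult_right_mono)
      then have "m * w + (m * w)\<^sup>2 \<le> 2 * real k * t * w"
        by (simp add: power2_eq_square algebra_simps)
      moreover have "3 / 2 ^ Suc k \<ge> (0::real)" by simp
      ultimately show ?thesis using up low Q by linarith
    qed
  qed
  then show ?thesis unfolding Q_def w_def by simp
qed

text \<open>Here \<open>t ^ k\<close> is at least of order \<open>1 / k\<close>, so
  \<open>1 - t\<close> is at most of order \<open>log k / k\<close>, and the constraint on
  \<open>t\<close> makes \<open>t ^ k\<close> at most twice \<open>1 - t\<close>. Hence the power on
  the left exceeds \<open>Q\<close> only by a factor near 1, while \<open>Q\<close> stays away from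
  1, so \<open>2 * Q\<close> absorbs both summands.\<close>

lemma kernel_bound_large_weight:
  fixes t :: real
  assumes t: "t \<ge> 0" "t + t ^ Suc k \<le> 1" and k: "k \<ge> 20" and weight: "real (Suc k) * t ^ k > 1/10"
    and decay: "real (Suc k) * (3/5) ^ k \<le> 1/10"
    and lnbound: "exp (2 * ln (10 * real (Suc k)) * (1 + ln (10 * real (Suc k))) / real k) \<le> 21/20"
  shows "(1 + t ^ k) ^ Suc k + 1 \<le> (2 + 3 / 2 ^ Suc k) * (1 + t ^ Suc k) ^ k"
proof -
  define w where "w = t ^ k"
  define m where "m = real (Suc k)"
  have w: "w \<ge> 0" and tw: "t ^ Suc k = t * w" using t by (simp_all add: w_def)
  have m: "m \<ge> 21" "real k = m - 1" using k by (simp_all add: m_def)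
  define Q where "Q = (1 + t * w) ^ k"
  have twn: "t * w \<ge> 0" using t w by simp
  have Q: "Q \<ge> 1 + real k * (t * w)"
    unfolding Q_def using twn by (intro Bernoulli_inequality) simp
  then have Q1: "Q \<ge> 1" using twn by (smt (verit) mult_nonneg_nonneg of_nat_0_le_iff)
  have kpos: "real k > 0" using k by simp
  have mw: "m * w > 1/10" using weight by (simp only: m_def w_def)
  have "(1 + w) ^ Suc k + 1 \<le> (2 + 3 / 2 ^ Suc k) * Q"
  proof -
    have t35: "t > 3/5"
    proof (rule ccontr)
      assume "\<not> t > 3/5"
      then have "w \<le> (3/5) ^ k" unfolding w_def using t by (intro power_mono) auto
      then have "m * w \<le> m * (3/5) ^ k" using m by (intro mult_left_mono) auto
      then show False using mw decay unfolding m_def by linarith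
    qed
    define \<delta> where "\<delta> = 1 - t"
    define l where "l = ln (10 * m)"
    have d0: "\<delta> \<ge> 0" using t w tw t35 unfolding \<delta>_def by (smt (verit) mult_nonneg_nonneg)
    have l0: "l \<ge> 0" using m by (simp add: l_def)
    have wp: "w > 0" using mw w m by (cases "w = 0") auto
    \<comment> \<open>Compares \<open>w \<le> exp (- \<delta> * k)\<close> with
      \<open>w > 1 / (10 * m)\<close>.\<close>
    have dk: "\<delta> * real k \<le> l"
    proof -
      have "1 - \<delta> \<le> exp (- \<delta>)" using exp_ge_add_one_self[of "-\<delta>"] by simp
      then have "w \<le> exp (- \<delta>) ^ k" unfolding w_def using t by (intro power_mono) (auto simp: \<delta>_def)
      also have "\<dots> = exp (- (\<delta> * real k))" by (simp add: exp_of_nat_mult[symmetric] mult.commute)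
      finally have "ln w \<le> ln (exp (- (\<delta> * real k)))" using wp by (simp only: ln_le_cancel_iff exp_gt_zero)
      then have "ln w \<le> - (\<delta> * real k)" by simp
      moreover have "0 \<le> ln (10 * m * w)" using mw by simp
      then have "0 \<le> l + ln w" unfolding l_def using m wp by (simp add: ln_mult)
      ultimately show ?thesis by simp
    qed
    \<comment> \<open>The constraint on \<open>t\<close> reads \<open>t * w \<le> \<delta>\<close>,
      and \<open>t > 3/5\<close> turns this into a bound on \<open>w\<close>.\<close>
    have wd: "w \<le> 2 * \<delta>"
    proof -
      have "t * w \<le> \<delta>" using t(2) unfolding tw \<delta>_def by linarith
      moreover have "(3/5) * w \<le> t * w" using t35 w by (intro mult_right_mono) auto
      ultimately show ?thesis using w by simp
    qed
    \<comment> \<open>Since \<open>t + \<delta> = 1\<close>, the base \<open>1 + w\<close> is at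
      most \<open>(1 + t * w) * (1 + \<delta> * w)\<close>. The ratio to \<open>Q\<close> is then at
      most \<open>exp (w * (1 + \<delta> * k))\<close>, whose exponent is of order at most
      \<open>(log k)^2 / k\<close>.\<close>
    have R: "(1 + w) ^ Suc k \<le> 21/20 * Q"
    proof -
      have "(1 + t * w) * (1 + \<delta> * w) = 1 + w + t * \<delta> * w\<^sup>2"
        by (simp add: \<delta>_def power2_eq_square algebra_simps)
      then have "1 + w \<le> (1 + t * w) * (1 + \<delta> * w)"
        using t d0 by simp
      also have "\<dots> \<le> (1 + t * w) * exp (\<delta> * w)"
        using t w by (intro mult_left_mono) auto
      finally have "(1 + w) ^ k \<le> ((1 + t * w) * exp (\<delta> * w)) ^ k"
        using w by (intro power_mono) auto
      also have "\<dots> = Q * exp (real k * \<delta> * w)"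
        by (simp add: Q_def power_mult_distrib exp_of_nat_mult[symmetric] mult.assoc)
      finally have "(1 + w) ^ Suc k \<le> exp w * (Q * exp (real k * \<delta> * w))"
        using w by (simp only: power_Suc) (intro mult_mono, auto)
      also have "\<dots> = Q * exp (w * (1 + \<delta> * real k))"
        by (simp add: algebra_simps exp_add)
      also have "\<dots> \<le> Q * exp (2 * l * (1 + l) / real k)"
      proof -
        have "\<delta> \<le> l / real k" using dk kpos by (simp add: field_simps)
        then have "w \<le> 2 * (l / real k)" using wd by simp
        then have "w * (1 + \<delta> * real k) \<le> (2 * (l / real k)) * (1 + l)"
          using dk w d0 l0 by (intro mult_mono) auto
        also have "\<dots> = 2 * l * (1 + l) / real k" by simp
        finally show ?thesis using Q1 by simp
      qed
      also have "\<dots> \<le> Q * (21/20)"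
        using lnbound Q1 by (intro mult_left_mono) (auto simp: l_def m_def)
      finally show ?thesis by simp
    qed
    have "real k * (t * w) \<ge> real k * (3/5 * w)"
      using t35 w by (intro mult_left_mono mult_right_mono) auto
    moreover have "m * w \<le> (21/20) * (real k * w)"
      using m w mult_right_mono[of m "21/20 * real k" w] by (simp only: mult.assoc) simp
    \<comment> \<open>\<open>21/20 * Q + 1 \<le> 2 * Q\<close> requires exactly 20/19, and
      \<open>k * t * w > 3/5 * 20/21 * 1/10 = 2/35 > 1/19\<close>.\<close>
    ultimately have "Q \<ge> 20/19" using Q mw by linarith
    then have "(1 + w) ^ Suc k + 1 \<le> 2 * Q" using R by simp
    also have "\<dots> \<le> (2 + 3 / 2 ^ Suc k) * Q" using Q1 by (intro mult_right_mono) auto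
    finally show ?thesis .
  qed
  then show ?thesis unfolding Q_def w_def by simp
qed

text \<open>The two weight regimes cover every admissible \<open>t\<close>, and their numerical
  hypotheses hold for all large \<open>k\<close>, uniformly in \<open>t\<close>. The constraint on
  \<open>t\<close> is removed by \<open>kernel_bound_extend\<close>.\<close>

lemma kernel_bound_eventually:
  "eventually (\<lambda>k. \<forall>t::real. t \<ge> 0 \<longrightarrow> t + t ^ Suc k \<le> 1 \<longrightarrow>
     (1 + t ^ k) ^ Suc k + 1 \<le> (2 + 3 / 2 ^ Suc k) * (1 + t ^ Suc k) ^ k) sequentially"
proof -
  have "eventually (\<lambda>k::nat. k \<ge> 20) sequentially" by (rule eventually_ge_at_top)
  moreover have "eventually (\<lambda>k. real (Suc k) * (3/5) ^ k \<le> 1/10) sequentially"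
    by real_asymp
  moreover have "eventually (\<lambda>k. real (Suc k) ^ 2 * (18/25) ^ k \<le> 1/2) sequentially"
    by real_asymp
  moreover have "eventually (\<lambda>k. exp (2 * ln (10 * real (Suc k)) * (1 + ln (10 * real (Suc k))) / real k) \<le> 21/20) sequentially"
    by real_asymp
  ultimately show ?thesis
    by eventually_elim (meson kernel_bound_small_weight kernel_bound_large_weight not_le)
qed

text \<open>
  The two weights t and \<tau> play symmetric roles before one of them is optimised. At the optimal
  \<tau> for a large t the original inequality is an equality in Hoelder, and applying Hoelder to the
  other weight bounds the same expression by the kernel at \<tau>, which is small.
\<close>

lemma kernel_bound_extend:
  fixes t \<Lambda> :: real
  assumes small: "\<And>t::real. t \<ge> 0 \<Longrightarrow> t + t ^ Suc k \<le> 1 \<Longrightarrow>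
     (1 + t ^ k) ^ Suc k + 1 \<le> \<Lambda> * (1 + t ^ Suc k) ^ k"
    and t: "t \<ge> 0"
  shows "(1 + t ^ k) ^ Suc k + 1 \<le> \<Lambda> * (1 + t ^ Suc k) ^ k"
proof (cases "t + t ^ Suc k \<le> 1")
  case True
  then show ?thesis using small t by blast
next
  case False
  define \<tau> where "\<tau> = 1 / (1 + t ^ k)"
  have p: "1 + t ^ k > 0" using t by (simp add: add_pos_nonneg)
  then have tau: "\<tau> > 0" and inv: "1 + t ^ k = 1 / \<tau>" by (simp_all add: \<tau>_def)
  \<comment> \<open>The case assumption says \<open>t * (1 + t ^ k) > 1\<close>. Then
    \<open>\<tau> * (1 + \<tau> ^ k) \<le> \<tau> * (1 + t ^ k) = 1\<close> puts
    \<open>\<tau>\<close> in the range of \<open>small\<close>.\<close>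
  have "\<tau> \<le> t" using False p by (simp add: \<tau>_def field_simps)
  then have "\<tau> * (1 + \<tau> ^ k) \<le> \<tau> * (1 + t ^ k)"
    using tau by (intro mult_left_mono add_left_mono power_mono) auto
  then have "\<tau> + \<tau> ^ Suc k \<le> 1" using inv tau by (simp add: algebra_simps)
  then have ih: "(1 + \<tau> ^ k) ^ Suc k + 1 \<le> \<Lambda> * (1 + \<tau> ^ Suc k) ^ k"
    using small tau by simp
  define Y where "Y = 1 + \<tau> ^ Suc k"
  have Y: "Y > 0" using tau by (simp add: Y_def add_pos_pos)
  have "(1 + t ^ k + \<tau> ^ k) ^ Suc k \<le> ((1 + \<tau> ^ k) ^ Suc k + 1) * (1 + t ^ Suc k) ^ k"
    using Hoelder_two_point[of "1 + \<tau> ^ k" 1 1 t k] tau t by (simp add: add_ac)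
  also have "\<dots> \<le> \<Lambda> * Y ^ k * (1 + t ^ Suc k) ^ k"
    unfolding Y_def using ih t by (intro mult_right_mono) auto
  \<comment> \<open>At this \<open>\<tau>\<close> the base is a multiple of \<open>Y\<close>, so
    \<open>Y ^ k\<close> cancels and exactly the expression to be bounded remains.\<close>
  also have "1 + t ^ k + \<tau> ^ k = Y / \<tau>"
    unfolding inv Y_def using tau by (simp add: field_simps)
  finally have "Y ^ k * (Y / \<tau> ^ Suc k) \<le> Y ^ k * (\<Lambda> * (1 + t ^ Suc k) ^ k)"
    by (simp add: power_divide algebra_simps)
  then have "Y / \<tau> ^ Suc k \<le> \<Lambda> * (1 + t ^ Suc k) ^ k"
    using Y by (simp only: mult_le_cancel_left_pos zero_less_power)
  moreover have "Y / \<tau> ^ Suc k = (1 + t ^ k) ^ Suc k + 1"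
    unfolding inv Y_def using tau by (simp add: power_divide add_divide_distrib)
  ultimately show ?thesis by simp
qed

section \<open>The weighted inequality on a one-element ground set\<close>

text \<open>In the application the variables are \<open>Suc k\<close>-th roots of the sizes of the
  subfamilies avoiding (index 0) and containing (index 1) an element; \<open>a1 * b1\<close> is
  absent because two sets containing it meet. Hoelder eliminates \<open>b0\<close> and
  \<open>b1\<close>, and homogeneity leaves the kernel at \<open>t = a1 / a0\<close>.\<close>

lemma two_point_inequality:
  fixes a0 a1 b0 b1 \<Lambda> :: real
  assumes kernel: "\<And>t::real. t \<ge> 0 \<Longrightarrow>
     (1 + t ^ k) ^ Suc k + 1 \<le> \<Lambda> * (1 + t ^ Suc k) ^ k"
    and nn: "a0 \<ge> 0" "a1 \<ge> 0" "b0 \<ge> 0" "b1 \<ge> 0" and k: "k > 0"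
  shows "((a0 * b0) ^ k + (a0 * b1) ^ k + (a1 * b0) ^ k) ^ Suc k
    \<le> \<Lambda> * ((a0 ^ Suc k + a1 ^ Suc k) * (b0 ^ Suc k + b1 ^ Suc k)) ^ k"
proof -
  have L: "\<Lambda> \<ge> 2" using kernel[of 0] k by (simp add: zero_power)
  have le: "(a0 ^ k + a1 ^ k) ^ Suc k + (a0 ^ k) ^ Suc k \<le> \<Lambda> * (a0 ^ Suc k + a1 ^ Suc k) ^ k"
  \<comment> \<open>\<open>a0 = 0\<close> is the limit of infinite \<open>t\<close>, where
    \<open>\<Lambda> \<ge> 1\<close> suffices.\<close>
  proof (cases "a0 = 0")
    case True
    have e: "(a1 ^ k) ^ Suc k = (a1 ^ Suc k) ^ k" by (simp only: power_mult[symmetric] mult.commute)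
    have "1 * (a1 ^ Suc k) ^ k \<le> \<Lambda> * (a1 ^ Suc k) ^ k" using L nn by (intro mult_right_mono) auto
    then show ?thesis using True k e by (simp del: power_Suc add: zero_power)
  next
    case False
    define t where "t = a1 / a0"
    have t: "t \<ge> 0" "a1 = t * a0" using nn False by (simp_all add: t_def)
    have e: "(a0 ^ k) ^ Suc k = (a0 ^ Suc k) ^ k" by (simp only: power_mult[symmetric] mult.commute)
    have "(a0 ^ k + a1 ^ k) ^ Suc k + (a0 ^ k) ^ Suc k = (a0 ^ k) ^ Suc k * ((1 + t ^ k) ^ Suc k + 1)"
    proof -
      have "a0 ^ k + a1 ^ k = a0 ^ k * (1 + t ^ k)" by (simp add: t(2) power_mult_distrib algebra_simps)
      then show ?thesis by (simp only: power_mult_distrib) (simp only: distrib_left mult_1_right)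
    qed
    also have "\<dots> \<le> (a0 ^ k) ^ Suc k * (\<Lambda> * (1 + t ^ Suc k) ^ k)"
      using kernel[OF t(1)] nn by (intro mult_left_mono) auto
    also have "\<dots> = \<Lambda> * (a0 ^ Suc k * (1 + t ^ Suc k)) ^ k"
      unfolding e by (simp only: power_mult_distrib mult_ac)
    also have "a0 ^ Suc k * (1 + t ^ Suc k) = a0 ^ Suc k + a1 ^ Suc k"
      unfolding t(2) power_mult_distrib by (simp only: distrib_left mult_1_right mult.commute)
    finally show ?thesis .
  qed
  have "(a0 * b0) ^ k + (a0 * b1) ^ k + (a1 * b0) ^ k = (a0 ^ k + a1 ^ k) * b0 ^ k + a0 ^ k * b1 ^ k"
    by (simp add: power_mult_distrib algebra_simps)
  then have "((a0 * b0) ^ k + (a0 * b1) ^ k + (a1 * b0) ^ k) ^ Suc k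
     \<le> ((a0 ^ k + a1 ^ k) ^ Suc k + (a0 ^ k) ^ Suc k) * (b0 ^ Suc k + b1 ^ Suc k) ^ k"
    using Hoelder_two_point[of "a0 ^ k + a1 ^ k" "a0 ^ k" b0 b1 k] nn by simp
  also have "\<dots> \<le> \<Lambda> * (a0 ^ Suc k + a1 ^ Suc k) ^ k * (b0 ^ Suc k + b1 ^ Suc k) ^ k"
    using nn by (intro mult_right_mono le) auto
  also have "\<dots> = \<Lambda> * ((a0 ^ Suc k + a1 ^ Suc k) * (b0 ^ Suc k + b1 ^ Suc k)) ^ k"
    by (simp only: power_mult_distrib mult.assoc)
  finally show ?thesis .
qed

section \<open>Counting disjoint pairs by induction on the ground set\<close>

text \<open>A double sum rather than a cardinality, so that each family can be split separately by
  linearity.\<close>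

definition disjoint_pairs :: "'a set set \<Rightarrow> 'a set set \<Rightarrow> nat" where
  "disjoint_pairs \<A> \<B> = (\<Sum>A\<in>\<A>. \<Sum>B\<in>\<B>. of_bool (A \<inter> B = {}))"

text \<open>Deleting \<open>x\<close> gives a family over the smaller ground set, to which the
  induction hypothesis applies.\<close>

definition link :: "'a \<Rightarrow> 'a set set \<Rightarrow> 'a set set" where
  "link x \<A> = (\<lambda>A. A - {x}) ` {A \<in> \<A>. x \<in> A}"

lemma disjoint_pairs_eq_card:
  assumes "finite \<A>" "finite \<B>"
  shows "disjoint_pairs \<A> \<B> = card {(A, B) \<in> \<A> \<times> \<B>. A \<inter> B = {}}"
proof -
  have "disjoint_pairs \<A> \<B> = card (\<A> \<times> \<B> \<inter> {p. fst p \<inter> snd p = {}})"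
    unfolding disjoint_pairs_def sum.cartesian_product case_prod_beta
    using assms by (subst sum_of_bool_eq) auto
  also have "\<A> \<times> \<B> \<inter> {p. fst p \<inter> snd p = {}} = {(A, B) \<in> \<A> \<times> \<B>. A \<inter> B = {}}" by auto
  finally show ?thesis .
qed

lemma sum_split_link:
  fixes f :: "'a set \<Rightarrow> nat"
  assumes "finite \<A>"
  shows "sum f \<A> = sum f {A \<in> \<A>. x \<notin> A} + (\<Sum>A\<in>link x \<A>. f (insert x A))"
proof -
  have "inj_on (\<lambda>A. A - {x}) {A \<in> \<A>. x \<in> A}" by (rule inj_onI) blast
  then have "(\<Sum>A\<in>link x \<A>. f (insert x A)) = (\<Sum>A\<in>{A \<in> \<A>. x \<in> A}. f (insert x (A - {x})))"
    unfolding link_def by (simp add: sum.reindex)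
  also have "\<dots> = sum f {A \<in> \<A>. x \<in> A}"
    by (intro sum.cong) (auto simp: insert_absorb)
  finally have "(\<Sum>A\<in>link x \<A>. f (insert x A)) = sum f {A \<in> \<A>. x \<in> A}" .
  moreover have "sum f \<A> = sum f ({A \<in> \<A>. x \<notin> A} \<union> {A \<in> \<A>. x \<in> A})"
    by (rule arg_cong[where f = "sum f"]) blast
  then have "sum f \<A> = sum f {A \<in> \<A>. x \<notin> A} + sum f {A \<in> \<A>. x \<in> A}"
    using assms by (subst (asm) sum.union_disjoint) auto
  ultimately show ?thesis by simp
qed

lemma card_split_link:
  assumes "finite \<A>"
  shows "card \<A> = card {A \<in> \<A>. x \<notin> A} + card (link x \<A>)"
  using sum_split_link[OF assms, of "\<lambda>_. 1" x] by simp

text \<open>Of the four blocks the one with \<open>x\<close> in both sets vanishes; in the others,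
  restoring \<open>x\<close> to at most one of the two sets does not affect disjointness.\<close>

lemma disjoint_pairs_split:
  assumes "finite \<A>" "finite \<B>"
  shows "disjoint_pairs \<A> \<B> =
    disjoint_pairs {A \<in> \<A>. x \<notin> A} {B \<in> \<B>. x \<notin> B}
    + disjoint_pairs {A \<in> \<A>. x \<notin> A} (link x \<B>)
    + disjoint_pairs (link x \<A>) {B \<in> \<B>. x \<notin> B}"
  unfolding disjoint_pairs_def
  by (simp add: sum_split_link[OF assms(1), of _ x] sum_split_link[OF assms(2), of _ x] sum.distrib)

text \<open>Tensorisation: the induction hypothesis bounds the three blocks, and \<open>two\<close>
  is what is needed to recombine them at the cost of one factor \<open>\<Lambda>\<close>.\<close>

lemma disjoint_pairs_bound:
  fixes \<Lambda> :: real
  assumes two: "\<And>a0 a1 b0 b1 :: real. a0 \<ge> 0 \<Longrightarrow> a1 \<ge> 0 \<Longrightarrow> b0 \<ge> 0 \<Longrightarrow> b1 \<ge> 0 \<Longrightarrow>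
      ((a0 * b0) ^ k + (a0 * b1) ^ k + (a1 * b0) ^ k) ^ Suc k
        \<le> \<Lambda> * ((a0 ^ Suc k + a1 ^ Suc k) * (b0 ^ Suc k + b1 ^ Suc k)) ^ k"
    and L: "\<Lambda> \<ge> 0"
    and S: "finite S" "\<A> \<subseteq> Pow S" "\<B> \<subseteq> Pow S"
  shows "real (disjoint_pairs \<A> \<B>) ^ Suc k \<le> \<Lambda> ^ card S * (real (card \<A>) * real (card \<B>)) ^ k"
  using S
proof (induction S arbitrary: \<A> \<B> rule: finite_induct)
  case empty
  then have "(\<A> = {} \<or> \<A> = {{}}) \<and> (\<B> = {} \<or> \<B> = {{}})" by auto
  then show ?case by (elim conjE disjE) (simp_all add: disjoint_pairs_def)
next
  case (insert x S)
  have fin: "finite \<A>" "finite \<B>"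
    using insert.prems insert.hyps(1) by (auto intro: finite_subset)
  \<comment> \<open>With \<open>Suc k\<close>-th roots the induction hypothesis bounds the counts
    themselves rather than their powers, so the three blocks can be added before \<open>two\<close>
    is applied.\<close>
  define rt where "rt = (\<lambda>\<X>::'a set set. root (Suc k) (real (card \<X>)))"
  have rt: "rt \<X> \<ge> 0" "rt \<X> ^ Suc k = real (card \<X>)" for \<X>
    by (simp_all add: rt_def del: power_Suc)
  define l where "l = root (Suc k) (\<Lambda> ^ card S)"
  have l: "l \<ge> 0" "l ^ Suc k = \<Lambda> ^ card S" using L by (simp_all add: l_def del: power_Suc)
  have IH: "real (disjoint_pairs \<X> \<Y>) \<le> l * (rt \<X> * rt \<Y>) ^ k"
    if "\<X> \<subseteq> Pow S" "\<Y> \<subseteq> Pow S" for \<X> \<Y>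
  proof (rule power_le_imp_le_base)
    have "(l * (rt \<X> * rt \<Y>) ^ k) ^ Suc k = l ^ Suc k * (rt \<X> ^ Suc k * rt \<Y> ^ Suc k) ^ k"
      by (simp only: power_mult_distrib power_mult[symmetric] mult.commute[of k])
    then show "real (disjoint_pairs \<X> \<Y>) ^ Suc k \<le> (l * (rt \<X> * rt \<Y>) ^ k) ^ Suc k"
      using insert.IH[OF that] by (simp only: rt l)
  qed (use l rt in auto)
  let ?A0 = "{A \<in> \<A>. x \<notin> A}" and ?A1 = "link x \<A>"
  let ?B0 = "{B \<in> \<B>. x \<notin> B}" and ?B1 = "link x \<B>"
  have sub: "?A0 \<subseteq> Pow S" "?A1 \<subseteq> Pow S" "?B0 \<subseteq> Pow S" "?B1 \<subseteq> Pow S"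
    using insert.prems by (auto simp: link_def)
  have "real (disjoint_pairs \<A> \<B>)
     \<le> l * ((rt ?A0 * rt ?B0) ^ k + (rt ?A0 * rt ?B1) ^ k + (rt ?A1 * rt ?B0) ^ k)"
    using IH[OF sub(1,3)] IH[OF sub(1,4)] IH[OF sub(2,3)]
    unfolding disjoint_pairs_split[OF fin, of x] by (simp add: distrib_left)
  then have "real (disjoint_pairs \<A> \<B>) ^ Suc k
     \<le> (l * ((rt ?A0 * rt ?B0) ^ k + (rt ?A0 * rt ?B1) ^ k + (rt ?A1 * rt ?B0) ^ k)) ^ Suc k"
    by (intro power_mono) auto
  also have "\<dots> = \<Lambda> ^ card S * ((rt ?A0 * rt ?B0) ^ k + (rt ?A0 * rt ?B1) ^ k + (rt ?A1 * rt ?B0) ^ k) ^ Suc k"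
    by (simp only: power_mult_distrib l)
  also have "\<dots> \<le> \<Lambda> ^ card S * (\<Lambda> *
      ((rt ?A0 ^ Suc k + rt ?A1 ^ Suc k) * (rt ?B0 ^ Suc k + rt ?B1 ^ Suc k)) ^ k)"
    using L rt by (intro mult_left_mono two) auto
  also have "\<dots> = \<Lambda> ^ card (insert x S) * (real (card \<A>) * real (card \<B>)) ^ k"
    using insert.hyps by (simp add: rt card_split_link[OF fin(1), of x] card_split_link[OF fin(2), of x] del: power_Suc)
      (simp add: mult_ac)
  finally show ?case .
qed

section \<open>From the count to the product of the cardinalities\<close>

text \<open>With \<open>m = Suc k\<close> and \<open>P\<close> the product of the cardinalities, the
  density hypothesis lets \<open>P ^ k\<close> cancel and leaves
  \<open>P \<le> 2 powr (\<theta> * n * m) * (2 + 3 / 2 ^ m) ^ n\<close>. The upper bound on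
  \<open>m\<close> costs a factor \<open>2 powr (\<theta> * n)\<close> in the first term, and the
  lower bound gives \<open>1 / 2 ^ m \<le> \<theta>\<close> for the second. The error exponents 1
  and 3/2 fit into 3.\<close>

lemma card_product_bound:
  fixes \<theta> :: real
  assumes bound: "real (disjoint_pairs \<A> \<B>) ^ Suc k
      \<le> (2 + 3 / 2 ^ Suc k) ^ n * (real (card \<A>) * real (card \<B>)) ^ k"
    and dens: "disjoint_density \<A> \<B> \<ge> 2 powr (- (\<theta> * real n))"
    and th: "0 < \<theta>" and m: "log 2 (1 / \<theta>) \<le> real (Suc k)" "real (Suc k) \<le> log 2 (1 / \<theta>) + 1"
    and fin: "finite \<A>" "finite \<B>"
  shows "real (card \<A>) * real (card \<B>)
    \<le> exp (3 * (\<theta> * real n)) * 2 powr (real n * (1 + \<theta> * log 2 (1 / \<theta>)))"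
proof -
  define P where "P = real (card \<A>) * real (card \<B>)"
  \<comment> \<open>An empty family would have density 0 through division by zero, so
    \<open>P\<close> is positive and may be cancelled.\<close>
  have "disjoint_density \<A> \<B> > 0" using dens by (smt (verit) powr_gt_zero)
  then have "P \<noteq> 0" unfolding disjoint_density_def P_def[symmetric] by auto
  moreover have "P \<ge> 0" by (simp add: P_def)
  ultimately have P: "P > 0" by simp
  have dP: "2 powr (- (\<theta> * real n)) * P \<le> real (disjoint_pairs \<A> \<B>)"
    using dens P unfolding disjoint_density_def disjoint_pairs_eq_card[OF fin] P_def
    by (simp only: pos_le_divide_eq)
  have "(2 powr (- (\<theta> * real n)) * P) ^ Suc k \<le> (2 + 3 / 2 ^ Suc k) ^ n * P ^ k"
    using power_mono[OF dP, of "Suc k"] bound P by (simp add: P_def)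
  then have "(2 powr (- (\<theta> * real n))) ^ Suc k * P * P ^ k \<le> (2 + 3 / 2 ^ Suc k) ^ n * P ^ k"
    by (simp only: power_mult_distrib) (simp add: mult_ac)
  then have 1: "(2 powr (- (\<theta> * real n))) ^ Suc k * P \<le> (2 + 3 / 2 ^ Suc k) ^ n"
    using P by simp
  have e: "(2 powr (- (\<theta> * real n))) ^ Suc k = 2 powr (- (\<theta> * real n * real (Suc k)))"
    by (subst powr_realpow[symmetric]) (simp, simp only: powr_powr, simp)
  have "P = 2 powr (\<theta> * real n * real (Suc k)) * ((2 powr (- (\<theta> * real n))) ^ Suc k * P)"
    unfolding e by (simp only: powr_minus) simp
  also have "\<dots> \<le> 2 powr (\<theta> * real n * real (Suc k)) * (2 + 3 / 2 ^ Suc k) ^ n"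
    using 1 by (intro mult_left_mono) auto
  also have "\<dots> \<le> 2 powr (\<theta> * real n * (log 2 (1 / \<theta>) + 1)) * (2 powr real n * exp (3/2 * \<theta> * real n))"
  proof (intro mult_mono)
    have "1 / \<theta> = 2 powr (log 2 (1 / \<theta>))" using th by simp
    also have "\<dots> \<le> 2 powr (real (Suc k))" using m by (intro powr_mono) auto
    also have "\<dots> = 2 ^ Suc k" by (simp only: powr_realpow)
    finally have "1 / 2 ^ Suc k \<le> \<theta>" using th by (simp add: field_simps)
    then have "2 + 3 / 2 ^ Suc k \<le> 2 * (1 + 3/2 * \<theta>)" by simp
    also have "\<dots> \<le> 2 * exp (3/2 * \<theta>)" by (intro mult_left_mono exp_ge_add_one_self) simp
    finally have "(2 + 3 / 2 ^ Suc k) ^ n \<le> (2 * exp (3/2 * \<theta>)) ^ n" by (intro power_mono) auto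
    also have "\<dots> = 2 powr real n * exp (3/2 * \<theta> * real n)"
      by (simp add: power_mult_distrib powr_realpow exp_of_nat_mult[symmetric] mult_ac)
    finally show "(2 + 3 / 2 ^ Suc k) ^ n \<le> 2 powr real n * exp (3/2 * \<theta> * real n)" .
  qed (use m th in \<open>auto intro!: mult_left_mono\<close>)
  also have "\<dots> = (2 powr (\<theta> * real n) * exp (3/2 * \<theta> * real n)) * 2 powr (real n * (1 + \<theta> * log 2 (1 / \<theta>)))"
    by (simp add: powr_add[symmetric] algebra_simps)
  also have "2 powr (\<theta> * real n) \<le> exp (\<theta> * real n)"
    using th ln_2_less_1 by (simp add: powr_def mult_left_le)
  then have "(2 powr (\<theta> * real n) * exp (3/2 * \<theta> * real n)) \<le> exp (\<theta> * real n) * exp (3/2 * \<theta> * real n)"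
    by (intro mult_right_mono) auto
  also have "\<dots> \<le> exp (3 * (\<theta> * real n))" using th by (simp flip: exp_add)
  finally show ?thesis by (simp add: P_def)
qed

lemma card_le_power:
  assumes "\<A> \<subseteq> Pow {1..n}" shows "real (card \<A>) \<le> 2 ^ n"
proof -
  have "card \<A> \<le> card (Pow {1..n})" using assms by (intro card_mono) auto
  then show ?thesis by (simp add: card_Pow flip: of_nat_le_iff)
qed

text \<open>For \<open>\<theta>\<close> at least \<open>1 / 2 ^ K\<close> the exponential factor
  alone is at least \<open>exp (2 * n)\<close>, which exceeds the trivial bound
  \<open>4 ^ n\<close>.\<close>

lemma card_product_trivial:
  fixes \<theta> :: real
  assumes "0 < \<theta>" "\<theta> < 1" "1 \<le> \<theta> * 2 ^ K" "\<A> \<subseteq> Pow {1..n}" "\<B> \<subseteq> Pow {1..n}"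
  shows "real (card \<A>) * real (card \<B>)
    \<le> exp (2 * 2 ^ K * (\<theta> * real n)) * 2 powr (real n * (1 + \<theta> * log 2 (1 / \<theta>)))"
proof -
  have "real (card \<A>) * real (card \<B>) \<le> 2 ^ n * 2 ^ n"
    using assms by (intro mult_mono card_le_power) auto
  also have "\<dots> \<le> exp 1 ^ n * exp 1 ^ n"
    using exp_ge_add_one_self[of 1] by (intro mult_mono power_mono) auto
  also have "\<dots> = exp (2 * real n)"
    by (simp add: exp_of_nat_mult[symmetric] flip: exp_add)
  also have "\<dots> \<le> exp (2 * 2 ^ K * (\<theta> * real n))"
    using mult_right_mono[OF assms(3), of "real n"] by (simp add: mult_ac)
  also have "\<dots> * 1 \<le> \<dots> * 2 powr (real n * (1 + \<theta> * log 2 (1 / \<theta>)))"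
    using assms by (intro mult_left_mono ge_one_powr_ge_zero mult_nonneg_nonneg add_nonneg_nonneg) auto
  finally show ?thesis by simp
qed

theorem theorem3p3:
  "\<exists>C::real. C > 0 \<and>
     (\<forall>(n::nat) (\<theta>::real) (\<A>::nat set set) (\<B>::nat set set).
        n \<ge> 2 \<longrightarrow> 0 < \<theta> \<longrightarrow> \<theta> < 1 \<longrightarrow>
        \<A> \<subseteq> Pow {1..n} \<longrightarrow> \<B> \<subseteq> Pow {1..n} \<longrightarrow>
        disjoint_density \<A> \<B> \<ge> 2 powr (- (\<theta> * real n)) \<longrightarrow>
        real (card \<A>) * real (card \<B>)
          \<le> exp (C * max (\<theta> * real n) (sqrt (\<theta> * real n * log 2 (real n))))
             * 2 powr (real n * (1 + \<theta> * log 2 (1 / \<theta>))))"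
proof -
  obtain K where K: "\<And>k t. k \<ge> K \<Longrightarrow> t \<ge> 0 \<Longrightarrow> t + t ^ Suc k \<le> 1 \<Longrightarrow>
     (1 + t ^ k) ^ Suc k + 1 \<le> (2 + 3 / 2 ^ Suc k) * (1 + t ^ Suc k :: real) ^ k"
    using kernel_bound_eventually unfolding eventually_sequentially by blast
  \<comment> \<open>The summands are the constants of the two regimes, so \<open>C\<close> dominates
    each of them.\<close>
  define C :: real where "C = 3 + 2 * 2 ^ (K + 1)"
  show ?thesis
  proof (intro exI[of _ C] conjI allI impI)
    show "C > 0" by (simp add: C_def add_pos_pos)
  next
    fix n :: nat and \<theta> :: real and \<A> \<B> :: "nat set set"
    assume th: "0 < \<theta>" "\<theta> < 1"
      and sub: "\<A> \<subseteq> Pow {1..n}" "\<B> \<subseteq> Pow {1..n}"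
      and dens: "disjoint_density \<A> \<B> \<ge> 2 powr (- (\<theta> * real n))"
    let ?M = "max (\<theta> * real n) (sqrt (\<theta> * real n * log 2 (real n)))"
    let ?R = "2 powr (real n * (1 + \<theta> * log 2 (1 / \<theta>)))"
    have scale: "exp (c * (\<theta> * real n)) * ?R \<le> exp (C * ?M) * ?R" if "0 \<le> c" "c \<le> C" for c
    proof -
      have "c * (\<theta> * real n) \<le> C * ?M" using that th by (intro mult_mono) auto
      then show ?thesis by (intro mult_right_mono) auto
    qed
    have fin: "finite \<A>" "finite \<B>" using sub by (auto intro: finite_subset)
    have pos: "0 < log 2 (1 / \<theta>)" using th by simp
    \<comment> \<open>\<open>Suc k\<close> is the rounded-up logarithm; \<open>\<theta> < 1\<close>
      makes the ceiling at least 1, so the natural subtraction does not truncate.\<close>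
    define k where "k = nat \<lceil>log 2 (1 / \<theta>)\<rceil> - 1"
    have "\<lceil>log 2 (1 / \<theta>)\<rceil> \<ge> 1" using pos by simp
    then have Sk: "real (Suc k) = of_int \<lceil>log 2 (1 / \<theta>)\<rceil>" unfolding k_def by (simp add: of_nat_diff)
    have m: "log 2 (1 / \<theta>) \<le> real (Suc k)" "real (Suc k) \<le> log 2 (1 / \<theta>) + 1"
      unfolding Sk by linarith+
    show "real (card \<A>) * real (card \<B>) \<le> exp (C * ?M) * ?R"
    proof (cases "k \<ge> K \<and> k > 0")
      case True
      have "real (disjoint_pairs \<A> \<B>) ^ Suc k
          \<le> (2 + 3 / 2 ^ Suc k) ^ card {1..n} * (real (card \<A>) * real (card \<B>)) ^ k"
      proof (rule disjoint_pairs_bound[OF two_point_inequality])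
        fix t :: real assume "t \<ge> 0"
        then show "(1 + t ^ k) ^ Suc k + 1 \<le> (2 + 3 / 2 ^ Suc k) * (1 + t ^ Suc k) ^ k"
          by - (rule kernel_bound_extend[OF K], use True in auto)
      qed (use True sub in auto)
      then have "real (card \<A>) * real (card \<B>) \<le> exp (3 * (\<theta> * real n)) * ?R"
        using card_product_bound[OF _ dens th(1) m fin] by simp
      also have "\<dots> \<le> exp (C * ?M) * ?R" by (rule scale) (simp_all add: C_def)
      finally show ?thesis .
    next
      case False
      \<comment> \<open>Both \<open>k < K\<close> and \<open>k = 0\<close> give this, so
        \<open>\<theta>\<close> is bounded below by \<open>1 / 2 ^ (K + 1)\<close>.\<close>
      then have "real (Suc k) \<le> real (K + 1)" by auto
      then have "log 2 (1 / \<theta>) \<le> real (K + 1)" using m(1) by linarith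
      then have "2 powr (log 2 (1 / \<theta>)) \<le> 2 powr (real (K + 1))" by (intro powr_mono) auto
      then have "1 / \<theta> \<le> 2 ^ (K + 1)" using th by (simp only: powr_realpow) simp
      then have "1 \<le> \<theta> * 2 ^ (K + 1)" using th by (simp add: field_simps)
      then have "real (card \<A>) * real (card \<B>) \<le> exp (2 * 2 ^ (K + 1) * (\<theta> * real n)) * ?R"
        using th sub by (intro card_product_trivial)
      also have "\<dots> \<le> exp (C * ?M) * ?R" by (rule scale) (simp_all add: C_def)
      finally show ?thesis .
    qed
  qed
qed

end
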